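(* Let $f_1,\dots,f_m:\mathbb{R}^n\to\mathbb{R}$ and $g_1,\dots,g_l:\mathbb{R}^n\to\mathbb{R}$ be convex functions, and consider the problem (MOP) of minimizing $f=(f_1,\dots,f_m)$ over $X=\{x\in\mathbb{R}^n: g_r(x)\le 0,\ r=1,\dots,l\}$. Let $x_0$ be a Pareto minimum of MOP and let the Slater constraint qualification hold. Then, for every decreasing sequence $\{\varepsilon_k\}$ of positive real numbers converging to $0$, there exist a sequence $\{x^k\}$ of feasible points converging to $x_0$ and a subsequence $\{y^k\}$ of $\{x^k\}$ such that each $y^k$ is a modified $\sigma_k$-KKT point of MOP with some $\sigma_k\in(0,\|e\|\varepsilon_k]$, where $e=(1,1,\dots,1)^T\in\mathbb{R}^m$.
   Context: Notation: $\|\cdot\|$ is the Euclidean norm, $\mathbb{R}^p_+$ is the nonnegative orthant, and $\partial^\circ h(x)$ is the Clarke subdifferential of a locally Lipschitz function $h$ at $x$, which for convex $h:\mathbb{R}^n\to\mathbb{R}$ coincides with the convex subdifferential $\partial h(x)=\{v\in\mathbb{R}^n: h(y)-h(x)\ge\langle v,y-x\rangle\ \text{for all } y\in\mathbb{R}^n\}$. Slater constraint qualification: there exists $\hat x\in X$ with $g_r(\hat x)<0$ for all $r=1,\dots,l$. Pareto minimum: a point $x_0\in X$ such that there is no $x\in X$ with $f(x)-f(x_0)\in-\mathbb{R}^m_+\setminus\{0\}$. Modified $\varepsilon$-KKT point: for $\varepsilon\in\mathbb{R}_+$, a feasible point $\bar x\in X$ is a modified $\varepsilon$-KKT point of MOP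 if there exists $x_\varepsilon\in\mathbb{R}^n$ with $\|\bar x-x_\varepsilon\|\le\sqrt{\varepsilon}$, and there exist $u_i\in\partial^\circ f_i(x_\varepsilon)$ for $i=1,\dots,m$, $v_r\in\partial^\circ g_r(x_\varepsilon)$ for $r=1,\dots,l$, $\lambda\in\mathbb{R}^m_+$ with $\|\lambda\|=1$ and $\mu\in\mathbb{R}^l_+$ such that $$\Big\|\sum_{i=1}^m\lambda_iu_i+\sum_{r=1}^l\mu_rv_r\Big\|\le\sqrt{\varepsilon}\quad\text{and}\quad \sum_{r=1}^l\mu_rg_r(\bar x)\ge-\varepsilon.$$ *)

theory Defs
  imports "HOL-Analysis.Analysis"
begin

definition nonneg_orthant :: "(real ^ 'p) set" where
  "nonneg_orthant = {z. \<forall>i. 0 \<le> z $ i}"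

(* Clarke's generalized directional derivative: the limsup of (h (y + t v) - h y) / t
   as y \<rightarrow> x and t \<down> 0.  The base point y = x is allowed, hence nhds rather than at.
   The limsup is taken in the extended reals, so that it always exists; it is finite
   whenever h is Lipschitz near x. *)
definition clarke_derivative ::
    "('a::real_inner \<Rightarrow> real) \<Rightarrow> 'a \<Rightarrow> 'a \<Rightarrow> ereal" where
  "clarke_derivative h x v =
     Limsup (nhds x \<times>\<^sub>F at_right 0) (\<lambda>(y, t). ereal ((h (y + t *\<^sub>R v) - h y) / t))"

definition clarke_subdifferential :: "('a::real_inner \<Rightarrow> real) \<Rightarrow> 'a \<Rightarrow> 'a set" where
  "clarke_subdifferential h x = {\<xi>. \<forall>v. ereal (\<xi> \<bullet> v) \<le> clarke_derivative h x v}"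

(* The functions g_1, ..., g_l (and likewise f_1, ..., f_m) are the components of one
   vector-valued map. *)
definition feasible_set :: "(real ^ 'n \<Rightarrow> real ^ 'l) \<Rightarrow> (real ^ 'n) set" where
  "feasible_set g = {x. \<forall>r. g x $ r \<le> 0}"

definition slater_cq :: "(real ^ 'n \<Rightarrow> real ^ 'l) \<Rightarrow> bool" where
  "slater_cq g \<longleftrightarrow> (\<exists>x\<in>feasible_set g. \<forall>r. g x $ r < 0)"

definition pareto_minimum ::
    "(real ^ 'n \<Rightarrow> real ^ 'm) \<Rightarrow> (real ^ 'n \<Rightarrow> real ^ 'l) \<Rightarrow> real ^ 'n \<Rightarrow> bool" where
  "pareto_minimum f g x0 \<longleftrightarrow>
     x0 \<in> feasible_set g \<and>
     \<not> (\<exists>x\<in>feasible_set g. f x - f x0 \<in> uminus ` nonneg_orthant - {0})"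

definition modified_KKT_point ::
    "(real ^ 'n \<Rightarrow> real ^ 'm) \<Rightarrow> (real ^ 'n \<Rightarrow> real ^ 'l) \<Rightarrow> real \<Rightarrow> real ^ 'n \<Rightarrow> bool" where
  "modified_KKT_point f g \<epsilon> x \<longleftrightarrow>
     0 \<le> \<epsilon> \<and> x \<in> feasible_set g \<and>
     (\<exists>x\<epsilon>. norm (x - x\<epsilon>) \<le> sqrt \<epsilon> \<and>
       (\<exists>(u :: 'm \<Rightarrow> real ^ 'n) (v :: 'l \<Rightarrow> real ^ 'n) (lam :: real ^ 'm) (\<mu> :: real ^ 'l).
          (\<forall>i. u i \<in> clarke_subdifferential (\<lambda>z. f z $ i) x\<epsilon>) \<and>
          (\<forall>r. v r \<in> clarke_subdifferential (\<lambda>z. g z $ r) x\<epsilon>) \<and>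
          lam \<in> nonneg_orthant \<and> norm lam = 1 \<and> \<mu> \<in> nonneg_orthant \<and>
          norm ((\<Sum>i\<in>UNIV. (lam $ i) *\<^sub>R u i) + (\<Sum>r\<in>UNIV. (\<mu> $ r) *\<^sub>R v r)) \<le> sqrt \<epsilon> \<and>
          (\<Sum>r\<in>UNIV. \<mu> $ r * g x $ r) \<ge> - \<epsilon>))"

end

theory Submission
  imports Defs
begin

text \<open>
  The Pareto minimum \<open>x0\<close> is itself an exact KKT point, so the constant sequence \<open>x0\<close> has
  all the required properties, with the point itself as the nearby point at which subgradients
  are taken and the largest admissible \<open>\<sigma>\<close> at every index.

  The exact multipliers come from one application of the separating hyperplane theorem
  (\<open>fritz_john_separation\<close>). Collect objectives and constraints into one finite family
  \<open>h j\<close> of convex functions with levels \<open>c j\<close> such that no point satisfies \<open>h j z < c j\<close> for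
  all \<open>j\<close> simultaneously. Allow every function its own perturbation \<open>w j\<close> of the argument and
  consider all \<open>(w, t)\<close> with \<open>h j (z + w j) - c j < t j\<close> for a common \<open>z\<close>.
  This set is convex and misses the origin. The \<open>t\<close> part of a separating functional gives the
  multipliers and its \<open>w\<close> part the scaled subgradients; since the common shift \<open>z\<close> is free,
  the scaled subgradients add up to zero. Slater's condition prevents the objective multipliers from all
  vanishing, so they can be normalised. Finally, a convex subgradient is a Clarke subgradient,
  because the difference quotients at the base point itself already dominate it.
\<close>

section \<open>Multipliers and subgradients from one separation\<close>

text \<open>
  The common shift ranges over a subspace \<open>S\<close> so that the lemma covers two extreme cases: for
  \<open>S = UNIV\<close> it yields the stationarity condition, and for \<open>S = {0}\<close>, where the hypothesis
  only concerns \<open>x0\<close>, it yields the existence of subgradients.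
\<close>

lemma fritz_john_separation:
  fixes h :: "'j::finite \<Rightarrow> 'a::euclidean_space \<Rightarrow> real"
  assumes conv: "\<And>j. convex_on UNIV (h j)"
    and S: "subspace S"
    and le: "\<And>j. h j x0 \<le> c j"
    and incompatible: "\<And>z. z \<in> S \<Longrightarrow> \<exists>j. c j \<le> h j (x0 + z)"
  obtains lam p where "\<And>j. 0 \<le> lam j" "\<exists>j. lam j \<noteq> 0"
    "\<And>j. lam j * h j x0 = lam j * c j"
    "\<And>j x. lam j * h j x0 + p j \<bullet> (x - x0) \<le> lam j * h j x"
    "\<And>z. z \<in> S \<Longrightarrow> (\<Sum>j\<in>UNIV. p j) \<bullet> z = 0"
proof -
  define A where "A = {(w :: 'a^'j, t :: real^'j). \<exists>z\<in>S. \<forall>j. h j (x0 + z + w $ j) - c j < t $ j}"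
  have "convex A"
  proof (rule convexI)
    fix a b :: "('a^'j) \<times> (real^'j)" and \<alpha> \<beta> :: real
    assume a: "a \<in> A" and b: "b \<in> A" and \<alpha>\<beta>: "0 \<le> \<alpha>" "0 \<le> \<beta>" "\<alpha> + \<beta> = 1"
    obtain w t z where z: "a = (w, t)" "z \<in> S" "\<And>j. h j (x0 + z + w $ j) - c j < t $ j"
      using a by (auto simp: A_def)
    obtain w' t' z' where z': "b = (w', t')" "z' \<in> S" "\<And>j. h j (x0 + z' + w' $ j) - c j < t' $ j"
      using b by (auto simp: A_def)
    have "h j (x0 + (\<alpha> *\<^sub>R z + \<beta> *\<^sub>R z') + (\<alpha> *\<^sub>R w + \<beta> *\<^sub>R w') $ j) - c j
            < (\<alpha> *\<^sub>R t + \<beta> *\<^sub>R t') $ j" for j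
    proof -
      have "x0 + (\<alpha> *\<^sub>R z + \<beta> *\<^sub>R z') + (\<alpha> *\<^sub>R w + \<beta> *\<^sub>R w') $ j
              = \<alpha> *\<^sub>R (x0 + z + w $ j) + \<beta> *\<^sub>R (x0 + z' + w' $ j)"
        using \<alpha>\<beta>(3) by (simp add: algebra_simps flip: scaleR_add_left)
      then have "h j (x0 + (\<alpha> *\<^sub>R z + \<beta> *\<^sub>R z') + (\<alpha> *\<^sub>R w + \<beta> *\<^sub>R w') $ j) - c j
          \<le> \<alpha> * h j (x0 + z + w $ j) + \<beta> * h j (x0 + z' + w' $ j) - c j"
        using conv[of j] \<alpha>\<beta> by (simp add: convex_on_def)
      also have "\<dots> = \<alpha> * (h j (x0 + z + w $ j) - c j) + \<beta> * (h j (x0 + z' + w' $ j) - c j)"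
        using \<alpha>\<beta>(3) by (simp add: algebra_simps flip: distrib_right distrib_left)
      also have "\<dots> < \<alpha> * t $ j + \<beta> * t' $ j"
      proof (cases "\<alpha> = 0")
        case True
        then show ?thesis using \<alpha>\<beta> z'(3)[of j] by simp
      next
        case False
        then have "\<alpha> * (h j (x0 + z + w $ j) - c j) < \<alpha> * t $ j"
          using \<alpha>\<beta>(1) z(3)[of j] by (intro mult_strict_left_mono) auto
        moreover have "\<beta> * (h j (x0 + z' + w' $ j) - c j) \<le> \<beta> * t' $ j"
          using \<alpha>\<beta>(2) z'(3)[of j] by (intro mult_left_mono) auto
        ultimately show ?thesis by linarith
      qed
      finally show ?thesis by simp
    qed
    moreover have "\<alpha> *\<^sub>R z + \<beta> *\<^sub>R z' \<in> S"
      using S z(2) z'(2) by (simp add: subspace_add subspace_mul)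
    ultimately show "\<alpha> *\<^sub>R a + \<beta> *\<^sub>R b \<in> A"
      unfolding A_def z(1) z'(1) by (auto simp del: vector_add_component vector_scaleR_component)
  qed
  moreover have "0 \<notin> A"
  proof
    assume "0 \<in> A"
    then obtain z where "z \<in> S" "\<And>j. h j (x0 + z) - c j < 0"
      by (auto simp: A_def zero_prod_def)
    with incompatible[of z] show False by (metis diff_ge_0_iff_ge not_less)
  qed
  ultimately obtain q lam where ne: "(q, lam) \<noteq> 0" and sep: "\<And>a. a \<in> A \<Longrightarrow> 0 \<le> (q, lam) \<bullet> a"
    using separating_hyperplane_set_0[of A] by (metis surj_pair)
  have strict: "0 \<le> (\<Sum>j\<in>UNIV. q $ j \<bullet> (y j - x0 - z)) + (\<Sum>j\<in>UNIV. lam $ j * (h j (y j) - c j))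
          + (\<Sum>j\<in>UNIV. lam $ j * s j)" if "z \<in> S" "\<And>j. 0 < s j" for y z s
  proof -
    have "((\<chi> j. y j - x0 - z), (\<chi> j. h j (y j) - c j + s j)) \<in> A"
      using that by (auto simp: A_def intro!: bexI[of _ z])
    from sep[OF this] show ?thesis
      by (simp add: inner_vec_def distrib_left sum.distrib)
  qed
  have nonneg: "0 \<le> lam $ j" for j
  proof (rule ccontr)
    assume neg: "\<not> 0 \<le> lam $ j"
    define K where "K = (\<Sum>k\<in>UNIV. lam $ k * (h k x0 - c k)) + (\<Sum>k\<in>UNIV. lam $ k)"
    \<comment> \<open>Raising only the \<open>j\<close>-th slack by \<open>r\<close> drives the separating functional down to
        \<open>K - (\<bar>K\<bar> + 1) < 0\<close>.\<close>
    define r where "r = (\<bar>K\<bar> + 1) / (- lam $ j)"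
    have "r > 0" using neg by (simp add: r_def divide_pos_neg)
    then have "0 \<le> (\<Sum>k\<in>UNIV. lam $ k * (h k x0 - c k))
            + (\<Sum>k\<in>UNIV. lam $ k * (1 + (if k = j then r else 0)))"
      using strict[of 0 "\<lambda>k. 1 + (if k = j then r else 0)" "\<lambda>_. x0"] S by (simp add: subspace_0)
    also have "\<dots> = K + lam $ j * r"
      by (simp add: K_def distrib_left sum.distrib if_distrib[of "(*) _"] cong: if_cong)
    also have "lam $ j * r = - (\<bar>K\<bar> + 1)"
      using neg by (simp add: r_def field_simps)
    finally show False by linarith
  qed
  have sepineq: "0 \<le> (\<Sum>j\<in>UNIV. q $ j \<bullet> (y j - x0 - z)) + (\<Sum>j\<in>UNIV. lam $ j * (h j (y j) - c j))"
    (is "0 \<le> ?K") if "z \<in> S" for y z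
  proof (rule field_le_epsilon)
    \<comment> \<open>Equal slacks \<open>e / (L + 1)\<close> contribute \<open>L * e / (L + 1) \<le> e\<close>.\<close>
    fix e :: real assume "0 < e"
    define L where "L = (\<Sum>j\<in>UNIV. lam $ j)"
    have L: "0 \<le> L" unfolding L_def by (intro sum_nonneg nonneg)
    have "0 \<le> ?K + (\<Sum>j\<in>UNIV. lam $ j * (e / (L + 1)))"
      using strict[OF that, of "\<lambda>_. e / (L + 1)" y] L \<open>0 < e\<close> by simp
    also have "(\<Sum>j\<in>UNIV. lam $ j * (e / (L + 1))) = L * (e / (L + 1))"
      by (simp only: L_def sum_distrib_right)
    also have "\<dots> \<le> e" using L \<open>0 < e\<close> by (simp add: field_simps)
    finally show "0 \<le> ?K + e" by simp
  qed
  have compl: "lam $ j * (h j x0 - c j) = 0" for j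
  proof -
    have "0 \<le> (\<Sum>j\<in>UNIV. lam $ j * (h j x0 - c j))"
      using sepineq[of 0 "\<lambda>_. x0"] S by (simp add: subspace_0)
    moreover have nonpos: "lam $ k * (h k x0 - c k) \<le> 0" for k
      using nonneg[of k] le[of k] by (intro mult_nonneg_nonpos) auto
    ultimately have "(\<Sum>j\<in>UNIV. - (lam $ j * (h j x0 - c j))) = 0"
      using sum_nonpos[of UNIV "\<lambda>j. lam $ j * (h j x0 - c j)"] by (simp add: sum_negf)
    then show ?thesis
      using sum_nonneg_eq_0_iff[of UNIV "\<lambda>j. - (lam $ j * (h j x0 - c j))"] nonpos by simp
  qed
  have subgrad: "0 \<le> q $ j \<bullet> (x - x0) + lam $ j * (h j x - c j)" for j x
  proof -
    \<comment> \<open>Moving only the \<open>j\<close>-th argument isolates the \<open>j\<close>-th term, the others being zero by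
        complementarity.\<close>
    let ?y = "\<lambda>k. if k = j then x else x0"
    have "(\<Sum>k\<in>UNIV. q $ k \<bullet> (?y k - x0 - 0)) = (\<Sum>k\<in>UNIV. if k = j then q $ k \<bullet> (x - x0) else 0)"
      by (intro sum.cong) auto
    moreover have "(\<Sum>k\<in>UNIV. lam $ k * (h k (?y k) - c k))
        = (\<Sum>k\<in>UNIV. if k = j then lam $ k * (h k x - c k) else 0)"
      using compl by (intro sum.cong) auto
    ultimately show ?thesis using sepineq[of 0 ?y] S by (simp add: subspace_0)
  qed
  show thesis
  proof (rule that[of "\<lambda>j. lam $ j" "\<lambda>j. - q $ j"])
    show "0 \<le> lam $ j" for j by (rule nonneg)
    show compl': "lam $ j * h j x0 = lam $ j * c j" for j
      using compl[of j] by (simp add: algebra_simps)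
    show "lam $ j * h j x0 + - q $ j \<bullet> (x - x0) \<le> lam $ j * h j x" for j x
      using subgrad[of j x] compl'[of j] unfolding right_diff_distrib inner_minus_left by linarith
    show "\<exists>j. lam $ j \<noteq> 0"
    proof (rule ccontr)
      assume *: "\<not> (\<exists>j. lam $ j \<noteq> 0)"
      then have "q $ j \<bullet> q $ j \<le> 0" for j
        using subgrad[of j "x0 - q $ j"] by simp
      then have "q $ j = 0" for j
        using inner_ge_zero[of "q $ j"] inner_eq_zero_iff[of "q $ j"] by (metis order_antisym)
      with * have "q = 0" "lam = 0" by (auto simp: vec_eq_iff)
      with ne show False by (simp add: zero_prod_def)
    qed
    have dir: "0 \<le> - ((\<Sum>j\<in>UNIV. q $ j) \<bullet> z)" if "z \<in> S" for z
      using sepineq[OF that, of "\<lambda>_. x0"] compl by (simp add: inner_sum_left sum_negf)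
    show "(\<Sum>j\<in>UNIV. - q $ j) \<bullet> z = 0" if "z \<in> S" for z
      using dir[OF that] dir[of "- z"] S that by (simp add: sum_negf subspace_neg)
  qed
qed

lemma convex_subgradient_exists:
  fixes h :: "'a::euclidean_space \<Rightarrow> real"
  assumes "convex_on UNIV h"
  obtains u where "\<And>x. h x0 + u \<bullet> (x - x0) \<le> h x"
proof -
  obtain lam :: "unit \<Rightarrow> real" and p where lam: "\<And>j. 0 \<le> lam j" "\<exists>j. lam j \<noteq> 0"
    and sub: "\<And>j x. lam j * h x0 + p j \<bullet> (x - x0) \<le> lam j * h x"
    using fritz_john_separation[of "\<lambda>_::unit. h" "{0}" x0 "\<lambda>_. h x0"] assms
    by (metis add.right_neutral empty_iff insert_iff order_refl subspace_single_0)
  have pos: "0 < lam ()" using lam by (auto simp: less_le)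
  show thesis
  proof (rule that[of "p () /\<^sub>R lam ()"])
    show "h x0 + (p () /\<^sub>R lam ()) \<bullet> (x - x0) \<le> h x" for x
      using sub[of "()" x] pos by (simp add: field_simps)
  qed
qed

text \<open>
  A scaled subgradient with positive multiplier can be divided by it. A zero multiplier forces
  the scaled subgradient to vanish, and then any subgradient may serve in its place.
\<close>

lemma fritz_john_subgradients:
  fixes h :: "'j::finite \<Rightarrow> 'a::euclidean_space \<Rightarrow> real"
  assumes conv: "\<And>j. convex_on UNIV (h j)"
    and le: "\<And>j. h j x0 \<le> c j"
    and incompatible: "\<And>z. \<exists>j. c j \<le> h j z"
  obtains lam u where "\<And>j. 0 \<le> lam j" "\<exists>j. lam j \<noteq> 0"
    "\<And>j. lam j * h j x0 = lam j * c j"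
    "\<And>j x. h j x0 + u j \<bullet> (x - x0) \<le> h j x"
    "(\<Sum>j\<in>UNIV. lam j *\<^sub>R u j) = 0"
proof -
  obtain lam p where lam: "\<And>j. 0 \<le> lam j" "\<exists>j. lam j \<noteq> 0"
    "\<And>j. lam j * h j x0 = lam j * c j"
    and sub: "\<And>j x. lam j * h j x0 + p j \<bullet> (x - x0) \<le> lam j * h j x"
    and orth: "\<And>z. z \<in> UNIV \<Longrightarrow> (\<Sum>j\<in>UNIV. p j) \<bullet> z = 0"
    using fritz_john_separation[of h UNIV x0 c] conv le incompatible subspace_UNIV by metis
  have "\<exists>u. (\<forall>x. h j x0 + u \<bullet> (x - x0) \<le> h j x) \<and> lam j *\<^sub>R u = p j" for j
  proof (cases "lam j = 0")
    case True
    then have "p j \<bullet> p j \<le> 0" using sub[of j "x0 + p j"] by simp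
    then have "p j = 0" using inner_ge_zero[of "p j"] inner_eq_zero_iff[of "p j"] by (metis order_antisym)
    moreover obtain u where "\<And>x. h j x0 + u \<bullet> (x - x0) \<le> h j x"
      using convex_subgradient_exists[OF conv] by metis
    ultimately show ?thesis using True by auto
  next
    case False
    then have pos: "0 < lam j" using lam(1)[of j] by simp
    have "h j x0 + (p j /\<^sub>R lam j) \<bullet> (x - x0) \<le> h j x" for x
      using sub[of j x] pos by (simp add: field_simps)
    with False show ?thesis by (intro exI[of _ "p j /\<^sub>R lam j"]) auto
  qed
  then obtain u where u: "\<And>j x. h j x0 + u j \<bullet> (x - x0) \<le> h j x" "\<And>j. lam j *\<^sub>R u j = p j"
    by metis
  have "(\<Sum>j\<in>UNIV. p j) = 0" using orth[of "\<Sum>j\<in>UNIV. p j"] by simp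
  then have "(\<Sum>j\<in>UNIV. lam j *\<^sub>R u j) = 0" by (simp add: u(2))
  with that lam u(1) show thesis by blast
qed

section \<open>Exact KKT conditions at a Pareto minimum\<close>

text \<open>
  By Pareto minimality no point improves all objectives strictly while satisfying all constraints
  strictly, so the objectives with levels \<open>f x0\<close> and the constraints with level \<open>0\<close> form an
  incompatible family. A level \<open>0\<close>, rather than the value at \<open>x0\<close>, makes the multiplier of an
  inactive constraint vanish. If all objective multipliers vanished, the combination
  of the constraints that remains would have to be nonnegative everywhere, yet it is negative
  at a Slater point.
\<close>

lemma pareto_minimum_exact_KKT:
  fixes f :: "real ^ 'n \<Rightarrow> real ^ 'm" and g :: "real ^ 'n \<Rightarrow> real ^ 'l"
  assumes convf: "\<And>i. convex_on UNIV (\<lambda>x. f x $ i)"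
    and convg: "\<And>r. convex_on UNIV (\<lambda>x. g x $ r)"
    and pareto: "pareto_minimum f g x0"
    and slater: "slater_cq g"
  obtains u v and lam :: "real ^ 'm" and \<mu> :: "real ^ 'l" where
    "\<And>i x. f x0 $ i + u i \<bullet> (x - x0) \<le> f x $ i"
    "\<And>r x. g x0 $ r + v r \<bullet> (x - x0) \<le> g x $ r"
    "lam \<in> nonneg_orthant" "norm lam = 1" "\<mu> \<in> nonneg_orthant"
    "(\<Sum>i\<in>UNIV. lam $ i *\<^sub>R u i) + (\<Sum>r\<in>UNIV. \<mu> $ r *\<^sub>R v r) = 0"
    "\<And>r. \<mu> $ r * g x0 $ r = 0"
proof -
  define h where "h = case_sum (\<lambda>i x. f x $ i) (\<lambda>r x. g x $ r)"
  define c :: "'m + 'l \<Rightarrow> real" where "c = case_sum (\<lambda>i. f x0 $ i) (\<lambda>r. 0)"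
  have feas: "g x0 $ r \<le> 0" for r
    using pareto by (simp add: pareto_minimum_def feasible_set_def)
  have "\<exists>j. c j \<le> h j z" for z
  proof (rule ccontr)
    assume "\<nexists>j. c j \<le> h j z"
    then have less: "h j z < c j" for j by (simp add: not_le)
    have "f z $ i < f x0 $ i" for i using less[of "Inl i"] by (simp add: h_def c_def)
    moreover have "g z $ r < 0" for r using less[of "Inr r"] by (simp add: h_def c_def)
    ultimately have "z \<in> feasible_set g" "f z - f x0 \<in> uminus ` nonneg_orthant - {0}"
      by (auto simp: feasible_set_def nonneg_orthant_def vec_eq_iff less_imp_le less_imp_neq
          intro!: image_eqI[of _ uminus "f x0 - f z"])
    with pareto show False by (auto simp: pareto_minimum_def)
  qed
  moreover have "convex_on UNIV (h j)" for j
    using convf convg by (cases j) (simp_all add: h_def)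
  moreover have "h j x0 \<le> c j" for j
    using feas by (cases j) (simp_all add: h_def c_def)
  ultimately obtain \<nu> \<xi> where \<nu>: "\<And>j. 0 \<le> \<nu> j" "\<exists>j. \<nu> j \<noteq> 0"
    and compl: "\<And>j. \<nu> j * h j x0 = \<nu> j * c j"
    and sub: "\<And>j x. h j x0 + \<xi> j \<bullet> (x - x0) \<le> h j x"
    and stat: "(\<Sum>j\<in>UNIV. \<nu> j *\<^sub>R \<xi> j) = 0"
    using fritz_john_subgradients[of h x0 c] by blast
  have split_sum: "(\<Sum>j\<in>UNIV. F j) = (\<Sum>i\<in>UNIV. F (Inl i)) + (\<Sum>r\<in>UNIV. F (Inr r))"
    for F :: "'m + 'l \<Rightarrow> real ^ 'n"
    unfolding UNIV_Plus_UNIV[symmetric] by (subst sum.Plus) (simp_all add: o_def)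
  define lam0 :: "real ^ 'm" where "lam0 = (\<chi> i. \<nu> (Inl i))"
  have "lam0 \<noteq> 0"
  proof
    assume "lam0 = 0"
    then have zero: "\<nu> (Inl i) = 0" for i by (simp add: lam0_def vec_eq_iff)
    obtain xs where xs: "\<And>r. g xs $ r < 0" using slater by (auto simp: slater_cq_def)
    have *: "\<nu> j * (\<xi> j \<bullet> (xs - x0)) \<le> \<nu> j * (h j xs - c j)" for j
      using mult_left_mono[OF sub[of j xs] \<nu>(1)[of j]] compl[of j] by (simp add: algebra_simps)
    obtain r where r: "\<nu> (Inr r) \<noteq> 0" using \<nu>(2) zero by (metis old.sum.exhaust)
    have "\<nu> j * (h j xs - c j) \<le> 0" for j
      using \<nu>(1)[of j] zero xs
      by (cases j) (auto simp: h_def c_def less_imp_le intro!: mult_nonneg_nonpos)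
    moreover have "\<nu> (Inr r) * (h (Inr r) xs - c (Inr r)) < 0"
      using r \<nu>(1)[of "Inr r"] mult_pos_neg[OF _ xs[of r], of "\<nu> (Inr r)"] by (simp add: h_def c_def)
    ultimately have "(\<Sum>j\<in>UNIV. \<nu> j * (h j xs - c j)) < (\<Sum>j\<in>(UNIV :: ('m + 'l) set). 0)"
      by (intro sum_strict_mono_ex1) auto
    moreover have "(\<Sum>j\<in>UNIV. \<nu> j * (\<xi> j \<bullet> (xs - x0))) \<le> (\<Sum>j\<in>UNIV. \<nu> j * (h j xs - c j))"
      by (intro sum_mono *)
    moreover have "(\<Sum>j\<in>UNIV. \<nu> j * (\<xi> j \<bullet> (xs - x0))) = (\<Sum>j\<in>UNIV. \<nu> j *\<^sub>R \<xi> j) \<bullet> (xs - x0)"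
      by (simp add: inner_sum_left)
    ultimately show False using stat by simp
  qed
  define N where "N = norm lam0"
  have N: "0 < N" using \<open>lam0 \<noteq> 0\<close> by (simp add: N_def)
  show thesis
  proof (rule that[of "\<lambda>i. \<xi> (Inl i)" "\<lambda>r. \<xi> (Inr r)" "lam0 /\<^sub>R N" "\<chi> r. \<nu> (Inr r) / N"])
    show "f x0 $ i + \<xi> (Inl i) \<bullet> (x - x0) \<le> f x $ i" for i x
      using sub[of "Inl i" x] by (simp add: h_def)
    show "g x0 $ r + \<xi> (Inr r) \<bullet> (x - x0) \<le> g x $ r" for r x
      using sub[of "Inr r" x] by (simp add: h_def)
    show "lam0 /\<^sub>R N \<in> nonneg_orthant" "(\<chi> r. \<nu> (Inr r) / N) \<in> nonneg_orthant"
      using \<nu>(1) N by (simp_all add: nonneg_orthant_def lam0_def)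
    show "norm (lam0 /\<^sub>R N) = 1" using N by (simp add: N_def)
    have "(\<Sum>i\<in>UNIV. (lam0 /\<^sub>R N) $ i *\<^sub>R \<xi> (Inl i))
        + (\<Sum>r\<in>UNIV. (\<chi> r. \<nu> (Inr r) / N) $ r *\<^sub>R \<xi> (Inr r)) = (\<Sum>j\<in>UNIV. \<nu> j *\<^sub>R \<xi> j) /\<^sub>R N"
      unfolding split_sum
      by (simp add: lam0_def scaleR_sum_right scaleR_add_right divide_inverse mult.commute)
    then show "(\<Sum>i\<in>UNIV. (lam0 /\<^sub>R N) $ i *\<^sub>R \<xi> (Inl i))
        + (\<Sum>r\<in>UNIV. (\<chi> r. \<nu> (Inr r) / N) $ r *\<^sub>R \<xi> (Inr r)) = 0"
      using stat by simp
    show "(\<chi> r. \<nu> (Inr r) / N) $ r * g x0 $ r = 0" for r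
      using compl[of "Inr r"] by (simp add: h_def c_def)
  qed
qed

section \<open>Modified KKT points\<close>

text \<open>
  Every set of the filter defining the limsup contains a pair \<open>(x0, t)\<close> with
  \<open>t > 0\<close>, and at such a pair the subgradient inequality bounds the difference quotient from below.
\<close>

lemma subgradient_in_clarke_subdifferential:
  assumes sub: "\<And>x. h x0 + u \<bullet> (x - x0) \<le> h x"
  shows "u \<in> clarke_subdifferential h x0"
proof -
  have "ereal (u \<bullet> v) \<le> clarke_derivative h x0 v" for v
    unfolding clarke_derivative_def Limsup_def
  proof (rule INF_greatest)
    fix P :: "'a \<times> real \<Rightarrow> bool"
    assume "P \<in> {P. eventually P (nhds x0 \<times>\<^sub>F at_right 0)}"
    then obtain Pf Pg where P: "eventually Pf (nhds x0)" "eventually Pg (at_right (0::real))"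
      "\<And>y t. Pf y \<Longrightarrow> Pg t \<Longrightarrow> P (y, t)"
      by (auto simp: eventually_prod_filter)
    have "eventually (\<lambda>t. Pg t \<and> 0 < t) (at_right (0::real))"
      using P(2) eventually_at_right_less[of "0::real"] by (rule eventually_conj)
    then obtain t :: real where t: "Pg t" "0 < t"
      using eventually_happens'[OF trivial_limit_at_right_real] by blast
    have "P (x0, t)" using P t(1) eventually_nhds_x_imp_x by blast
    moreover have "u \<bullet> v \<le> (h (x0 + t *\<^sub>R v) - h x0) / t"
      using sub[of "x0 + t *\<^sub>R v"] t(2) by (simp add: field_simps)
    ultimately show "ereal (u \<bullet> v)
        \<le> (SUP x\<in>{x. P x}. case x of (y, t) \<Rightarrow> ereal ((h (y + t *\<^sub>R v) - h y) / t))"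
      by (intro SUP_upper2[of "(x0, t)"]) auto
  qed
  then show ?thesis by (simp add: clarke_subdifferential_def)
qed

theorem theorem3p10:
  fixes f :: "real ^ 'n \<Rightarrow> real ^ 'm"
    and g :: "real ^ 'n \<Rightarrow> real ^ 'l"
    and x0 :: "real ^ 'n"
    and \<epsilon> :: "nat \<Rightarrow> real"
  assumes "\<And>i. convex_on UNIV (\<lambda>x. f x $ i)"
    and "\<And>r. convex_on UNIV (\<lambda>x. g x $ r)"
    and "pareto_minimum f g x0"
    and "slater_cq g"
    and "decseq \<epsilon>"
    and "\<And>k. 0 < \<epsilon> k"
    and "\<epsilon> \<longlonglongrightarrow> 0"
  shows "\<exists>x :: nat \<Rightarrow> real ^ 'n.
           (\<forall>k. x k \<in> feasible_set g) \<and> x \<longlonglongrightarrow> x0 \<and>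
           (\<exists>s y. strict_mono (s :: nat \<Rightarrow> nat) \<and> y = x \<circ> s \<and>
             (\<forall>k. \<exists>\<sigma>. 0 < \<sigma> \<and> \<sigma> \<le> norm ((\<chi> i. 1) :: real ^ 'm) * \<epsilon> k \<and>
                modified_KKT_point f g \<sigma> (y k)))"
proof -
  obtain u v and lam :: "real ^ 'm" and \<mu> :: "real ^ 'l" where
    u: "\<And>i x. f x0 $ i + u i \<bullet> (x - x0) \<le> f x $ i"
    and v: "\<And>r x. g x0 $ r + v r \<bullet> (x - x0) \<le> g x $ r"
    and mult: "lam \<in> nonneg_orthant" "norm lam = 1" "\<mu> \<in> nonneg_orthant"
    and stat: "(\<Sum>i\<in>UNIV. lam $ i *\<^sub>R u i) + (\<Sum>r\<in>UNIV. \<mu> $ r *\<^sub>R v r) = 0"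
    and compl: "\<And>r. \<mu> $ r * g x0 $ r = 0"
    using pareto_minimum_exact_KKT[OF assms(1-4)] by blast
  have feas: "x0 \<in> feasible_set g" using assms(3) by (simp add: pareto_minimum_def)
  have KKT: "modified_KKT_point f g \<sigma> x0" if "0 < \<sigma>" for \<sigma>
  proof -
    have "u i \<in> clarke_subdifferential (\<lambda>z. f z $ i) x0" for i
      by (rule subgradient_in_clarke_subdifferential) (rule u)
    moreover have "v r \<in> clarke_subdifferential (\<lambda>z. g z $ r) x0" for r
      by (rule subgradient_in_clarke_subdifferential) (rule v)
    moreover have "norm (x0 - x0) \<le> sqrt \<sigma>" using that by simp
    moreover have "norm ((\<Sum>i\<in>UNIV. lam $ i *\<^sub>R u i) + (\<Sum>r\<in>UNIV. \<mu> $ r *\<^sub>R v r)) \<le> sqrt \<sigma>"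
      unfolding stat using that by simp
    moreover have "(\<Sum>r\<in>UNIV. \<mu> $ r * g x0 $ r) \<ge> - \<sigma>" using that by (simp only: compl) simp
    ultimately show ?thesis
      unfolding modified_KKT_point_def using that feas mult less_imp_le by blast
  qed
  have "((\<chi> i. 1) :: real ^ 'm) \<noteq> 0" by (simp add: vec_eq_iff)
  then have pos: "0 < norm ((\<chi> i. 1) :: real ^ 'm) * \<epsilon> k" for k
    using assms(6) by simp
  show ?thesis
  proof (intro exI[of _ "\<lambda>_. x0"] conjI allI)
    show "\<exists>s y. strict_mono (s :: nat \<Rightarrow> nat) \<and> y = (\<lambda>_. x0) \<circ> s \<and>
             (\<forall>k. \<exists>\<sigma>. 0 < \<sigma> \<and> \<sigma> \<le> norm ((\<chi> i. 1) :: real ^ 'm) * \<epsilon> k \<and>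
                modified_KKT_point f g \<sigma> (y k))"
      using pos KKT by (intro exI[of _ id] exI[of _ "\<lambda>_. x0"]) (auto simp: strict_mono_id)
  qed (use feas in auto)
qed

end
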